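(* Let $(\Phi,\mathfrak N,\mathfrak T,\mathfrak R,\mathfrak S,\phi_{\mathrm{start}},\Sigma,\mathrm{Lex},\mathrm{Sel})$ be a parameterized local lexing and $D\in\Sigma^*$ an input. For every parameterized item $x$, the set $\overline{x}$ of its induced items is non-empty.
   Context: Parameterized local lexing: $\Phi$ is a non-empty set of parameters; $\mathfrak N,\mathfrak T$ are disjoint sets of nonterminals and terminals; $\mathfrak S\in\mathfrak N$, $\phi_{\mathrm{start}}\in\Phi$; $\mathfrak R$ is a set of parameterized rules, each of the form $N_{f_{k+1}}\to X_1^{f_1}\cdots X_k^{f_k}$ with $k\ge0$, $N\in\mathfrak N$, $X_1,\dots,X_k\in\mathfrak N\cup\mathfrak T$, and partial functions $f_i:\Phi^{2i-1}\rightharpoonup\Phi$ for $i=1,\dots,k+1$; $\Sigma$ is a set of characters; $\mathrm{Lex}$ and $\mathrm{Sel}$ are a lexer and selector (not needed here). Sequences are indexed from $0$; juxtaposition denotes concatenation; $\mathrm{take}_n\,s$ is the prefix of length $n$ of $s$. For partial functions $f_1,\dots,f_u$ ($u\ge1$, $f_i:\Phi^{2i-1}\rightharpoonup\Phi$), $\langle f_1,\dots,f_u\rangle$ is the set of $\rho=(\rho_0,\dots,\rho_{2u-1})\in\Phi^{2u}$ such that for each $i=1,\dots,u$, $f_i$ is defined at $(\rho_0,\dots,\rho_{2i-2})$ and $\rho_{2i-1}=f_i(\rho_0,\dots,\rho_{2i-2})$. Induced grammar: nonterminals $\overline{\mathfrak N}=(\mathfrak N\times\Phi\times\Phi)\cup\{\top,\bot\}$,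 terminals $\overline{\mathfrak T}=\mathfrak T\times\Phi\times\Phi$, start symbol $\top$; write $N^\alpha_\beta$ for $(N,\alpha,\beta)$ and $t^\alpha_\beta$ for $(t,\alpha,\beta)$. Rules: $\overline{\mathfrak R}=\{\top\to\mathfrak S^{\phi_{\mathrm{start}}}_\beta\mid\beta\in\Phi\}\cup\bigcup_{r\in\mathfrak R}\overline r$, where for $r=N_{f_{k+1}}\to X_1^{f_1}\cdots X_k^{f_k}$ the set $\overline r$ consists of (i) all rules $N^\alpha_\beta\to(X_1)^{\alpha_1}_{\beta_1}\cdots(X_k)^{\alpha_k}_{\beta_k}$ with $(\alpha,\alpha_1,\beta_1,\dots,\alpha_k,\beta_k,\beta)\in\langle f_1,\dots,f_{k+1}\rangle$, and (ii) all rules $N^\alpha_\beta\to(X_1)^{\alpha_1}_{\beta_1}\cdots(X_h)^{\alpha_h}_{\beta_h}\,\bot$ with $h\in\{1,\dots,k\}$, $\beta,\beta_h\in\Phi$, $(\alpha,\alpha_1,\beta_1,\dots,\alpha_{h-1},\beta_{h-1},\alpha_h)\in\langle f_1,\dots,f_h\rangle$ and $f_{h+1}$ undefined at $(\alpha,\alpha_1,\beta_1,\dots,\alpha_h,\beta_h)$. A parameterized item is a tuple $(r,d,i,j,\rho)$ with $r=N_{f_{k+1}}\to X_1^{f_1}\cdots X_k^{f_k}\in\mathfrak R$, $0\le d\le k$, $0\le i\le j\le|D|$ and $\rho\in\langle f_1,\dots,f_{d+1}\rangle$. An ordinary item is $(q,d,i,j)$ with $q=(L\to w)\in\overline{\mathfrak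 R}$, $0\le d\le|w|$, $0\le i\le j\le|D|$. For a parameterized item $x=(r,d,i,j,\rho)$, $\overline x$ is the set of: all $(q,d,i,j)$ where $q=N^\alpha_\beta\to(X_1)^{\alpha_1}_{\beta_1}\cdots(X_k)^{\alpha_k}_{\beta_k}\in\overline r$ is of type (i) and $\mathrm{take}_{2(d+1)}(\alpha,\alpha_1,\beta_1,\dots,\alpha_k,\beta_k,\beta)=\rho$; and all $(q,d,i,j)$ where $q=N^\alpha_\beta\to(X_1)^{\alpha_1}_{\beta_1}\cdots(X_h)^{\alpha_h}_{\beta_h}\bot\in\overline r$ is of type (ii), $d\le h-1$, and $\mathrm{take}_{2(d+1)}(\alpha,\alpha_1,\beta_1,\dots,\alpha_{h-1},\beta_{h-1},\alpha_h)=\rho$. *)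

theory Defs
  imports Main
begin

type_synonym 'p pfun = "'p list \<Rightarrow> 'p option"

text \<open>\<open>PRule N [(X\<^sub>1, f\<^sub>1), \<dots>, (X\<^sub>k, f\<^sub>k)] f\<^sub>k\<^sub>+\<^sub>1\<close> stands for the parameterized rule with left-hand side
  \<open>N\<close> annotated by \<open>f\<^sub>k\<^sub>+\<^sub>1\<close> and right-hand side symbols \<open>X\<^sub>l\<close> annotated by \<open>f\<^sub>l\<close>.\<close>

datatype ('s, 'p) prule =
  PRule (prule_lhs: 's) (prule_rhs: "('s \<times> 'p pfun) list") (prule_final: "'p pfun")

definition prule_syms :: "('s, 'p) prule \<Rightarrow> 's list" where
  "prule_syms r = map fst (prule_rhs r)"

text \<open>The list \<open>[f\<^sub>1, \<dots>, f\<^sub>k\<^sub>+\<^sub>1]\<close>; the function \<open>f\<^sub>i\<close> sits at position \<open>i - 1\<close>.\<close>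

definition prule_funs :: "('s, 'p) prule \<Rightarrow> 'p pfun list" where
  "prule_funs r = map snd (prule_rhs r) @ [prule_final r]"

text \<open>Nothing below depends on the lexer and the selector, so their types are left arbitrary
  and no condition is imposed on them.\<close>

record ('p, 's, 'c, 'lexer, 'selector) pll =
  params :: "'p set"
  nonterminals :: "'s set"
  terminals :: "'s set"
  prules :: "('s, 'p) prule set"
  start_symbol :: 's
  start_param :: 'p
  characters :: "'c set"
  lexer :: 'lexer
  selector :: 'selector

definition partial_function_on :: "'p set \<Rightarrow> nat \<Rightarrow> 'p pfun \<Rightarrow> bool" where
  "partial_function_on \<Phi> n f \<longleftrightarrow>
     dom f \<subseteq> {xs. length xs = n \<and> set xs \<subseteq> \<Phi>} \<and> ran f \<subseteq> \<Phi>"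

definition wf_prule :: "'p set \<Rightarrow> 's set \<Rightarrow> 's set \<Rightarrow> ('s, 'p) prule \<Rightarrow> bool" where
  "wf_prule \<Phi> N T r \<longleftrightarrow>
     prule_lhs r \<in> N \<and>
     set (prule_syms r) \<subseteq> N \<union> T \<and>
     (\<forall>i < length (prule_funs r). partial_function_on \<Phi> (2 * i + 1) (prule_funs r ! i))"

definition parameterized_local_lexing ::
  "('p, 's, 'c, 'lexer, 'selector) pll \<Rightarrow> bool" where
  "parameterized_local_lexing P \<longleftrightarrow>
     params P \<noteq> {} \<and>
     nonterminals P \<inter> terminals P = {} \<and>
     start_symbol P \<in> nonterminals P \<and>
     start_param P \<in> params P \<and>
     (\<forall>r \<in> prules P. wf_prule (params P) (nonterminals P) (terminals P) r)"

text \<open>The set \<open>\<langle>f\<^sub>1, \<dots>, f\<^sub>u\<rangle>\<close>.\<close>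

definition tuples :: "'p set \<Rightarrow> 'p pfun list \<Rightarrow> 'p list set" where
  "tuples \<Phi> fs = {\<rho>. length \<rho> = 2 * length fs \<and> set \<rho> \<subseteq> \<Phi> \<and>
     (\<forall>i < length fs. (fs ! i) (take (2 * i + 1) \<rho>) = Some (\<rho> ! (2 * i + 1)))}"

datatype ('s, 'p) isym = Sym 's 'p 'p | Top | Bot

type_synonym ('s, 'p) irule = "('s, 'p) isym \<times> ('s, 'p) isym list"

text \<open>For \<open>\<tau> = [\<alpha>, \<alpha>\<^sub>1, \<beta>\<^sub>1, \<alpha>\<^sub>2, \<beta>\<^sub>2, \<dots>]\<close> the parameters \<open>\<alpha>\<^sub>l\<^sub>+\<^sub>1\<close> and \<open>\<beta>\<^sub>l\<^sub>+\<^sub>1\<close> are found at positions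
  \<open>2 * l + 1\<close> and \<open>2 * l + 2\<close>.\<close>

definition annotate :: "'s list \<Rightarrow> 'p list \<Rightarrow> ('s, 'p) isym list" where
  "annotate Xs \<tau> = map (\<lambda>l. Sym (Xs ! l) (\<tau> ! (2 * l + 1)) (\<tau> ! (2 * l + 2))) [0..<length Xs]"

text \<open>Here \<open>\<tau> = [\<alpha>, \<alpha>\<^sub>1, \<beta>\<^sub>1, \<dots>, \<alpha>\<^sub>k, \<beta>\<^sub>k, \<beta>]\<close>.\<close>

definition complete_rule :: "('s, 'p) prule \<Rightarrow> 'p list \<Rightarrow> ('s, 'p) irule" where
  "complete_rule r \<tau> =
     (Sym (prule_lhs r) (\<tau> ! 0) (\<tau> ! (2 * length (prule_syms r) + 1)),
      annotate (prule_syms r) \<tau>)"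

text \<open>Here \<open>\<sigma> = [\<alpha>, \<alpha>\<^sub>1, \<beta>\<^sub>1, \<dots>, \<alpha>\<^sub>h\<^sub>-\<^sub>1, \<beta>\<^sub>h\<^sub>-\<^sub>1, \<alpha>\<^sub>h]\<close>, and \<open>b\<close> is \<open>\<beta>\<^sub>h\<close>.\<close>

definition blocked_rule ::
  "('s, 'p) prule \<Rightarrow> nat \<Rightarrow> 'p list \<Rightarrow> 'p \<Rightarrow> 'p \<Rightarrow> ('s, 'p) irule" where
  "blocked_rule r h \<sigma> b \<beta> =
     (Sym (prule_lhs r) (\<sigma> ! 0) \<beta>,
      annotate (take h (prule_syms r)) (\<sigma> @ [b]) @ [Bot])"

text \<open>The admissible data \<open>(h, \<sigma>, \<beta>\<^sub>h, \<beta>)\<close> of the rules ending in \<open>Bot\<close>; \<open>prule_funs r ! h\<close> is \<open>f\<^sub>h\<^sub>+\<^sub>1\<close>.\<close>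

definition blocked :: "'p set \<Rightarrow> ('s, 'p) prule \<Rightarrow> nat \<Rightarrow> 'p list \<Rightarrow> 'p \<Rightarrow> 'p \<Rightarrow> bool" where
  "blocked \<Phi> r h \<sigma> b \<beta> \<longleftrightarrow>
     h \<in> {1..length (prule_syms r)} \<and> \<beta> \<in> \<Phi> \<and> b \<in> \<Phi> \<and>
     \<sigma> \<in> tuples \<Phi> (take h (prule_funs r)) \<and>
     (prule_funs r ! h) (\<sigma> @ [b]) = None"

definition induced_rules_of :: "'p set \<Rightarrow> ('s, 'p) prule \<Rightarrow> ('s, 'p) irule set" where
  "induced_rules_of \<Phi> r =
     {complete_rule r \<tau> | \<tau>. \<tau> \<in> tuples \<Phi> (prule_funs r)} \<union>
     {blocked_rule r h \<sigma> b \<beta> | h \<sigma> b \<beta>. blocked \<Phi> r h \<sigma> b \<beta>}"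

record 'a cfg =
  cfg_nonterminals :: "'a set"
  cfg_terminals :: "'a set"
  cfg_rules :: "('a \<times> 'a list) set"
  cfg_start :: 'a

definition induced_grammar ::
  "('p, 's, 'c, 'lexer, 'selector) pll \<Rightarrow> ('s, 'p) isym cfg" where
  "induced_grammar P =
     \<lparr>cfg_nonterminals =
        {Sym N \<alpha> \<beta> | N \<alpha> \<beta>. N \<in> nonterminals P \<and> \<alpha> \<in> params P \<and> \<beta> \<in> params P} \<union> {Top, Bot},
      cfg_terminals =
        {Sym t \<alpha> \<beta> | t \<alpha> \<beta>. t \<in> terminals P \<and> \<alpha> \<in> params P \<and> \<beta> \<in> params P},
      cfg_rules =
        {(Top, [Sym (start_symbol P) (start_param P) \<beta>]) | \<beta>. \<beta> \<in> params P} \<union>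
        (\<Union>r \<in> prules P. induced_rules_of (params P) r),
      cfg_start = Top\<rparr>"

type_synonym ('s, 'p) pitem = "('s, 'p) prule \<times> nat \<times> nat \<times> nat \<times> 'p list"

type_synonym 'a item = "('a \<times> 'a list) \<times> nat \<times> nat \<times> nat"

definition parameterized_items ::
  "('p, 's, 'c, 'lexer, 'selector) pll \<Rightarrow> 'c list \<Rightarrow> ('s, 'p) pitem set" where
  "parameterized_items P D =
     {(r, d, i, j, \<rho>). r \<in> prules P \<and> d \<le> length (prule_syms r) \<and> i \<le> j \<and> j \<le> length D \<and>
        \<rho> \<in> tuples (params P) (take (d + 1) (prule_funs r))}"

definition items :: "'a cfg \<Rightarrow> 'c list \<Rightarrow> 'a item set" where
  "items G D =
     {(q, d, i, j). q \<in> cfg_rules G \<and> d \<le> length (snd q) \<and> i \<le> j \<and> j \<le> length D}"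

fun induced_items ::
  "('p, 's, 'c, 'lexer, 'selector) pll \<Rightarrow> ('s, 'p) pitem \<Rightarrow> ('s, 'p) isym item set" where
  "induced_items P (r, d, i, j, \<rho>) =
     {(complete_rule r \<tau>, d, i, j) | \<tau>.
        \<tau> \<in> tuples (params P) (prule_funs r) \<and> take (2 * (d + 1)) \<tau> = \<rho>} \<union>
     {(blocked_rule r h \<sigma> b \<beta>, d, i, j) | h \<sigma> b \<beta>.
        blocked (params P) r h \<sigma> b \<beta> \<and> d \<le> h - 1 \<and> take (2 * (d + 1)) \<sigma> = \<rho>}"

lemma induced_items_subset_items:
  assumes "x \<in> parameterized_items P D"
  shows "induced_items P x \<subseteq> items (induced_grammar P) D"
  using assms
  by (cases x)
    (fastforce simp: parameterized_items_def items_def induced_grammar_def induced_rules_of_def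
      complete_rule_def blocked_rule_def annotate_def blocked_def)

end

theory Submission
  imports Defs
begin

text \<open>Extend \<open>\<rho>\<close> greedily: append an arbitrary parameter \<open>b\<close> as the next \<open>\<beta>\<^sub>h\<close>. If the next
  function is undefined there, a rule ending in \<open>\<bottom>\<close> is induced; otherwise append its value
  and continue, until the tuple is complete.\<close>

lemma length_prule_funs: "length (prule_funs r) = Suc (length (prule_syms r))"
  by (simp add: prule_funs_def prule_syms_def)

text \<open>The conditions for \<open>fs\<close> only inspect entries inside \<open>\<rho>\<close>,
  so appending leaves them intact; the sole new condition evaluates \<open>f\<close> at
  \<open>\<rho> @ [b]\<close>.\<close>

lemma tuples_snoc:
  assumes "\<rho> \<in> tuples \<Phi> fs" "b \<in> \<Phi>" "c \<in> \<Phi>" "f (\<rho> @ [b]) = Some c"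
  shows "\<rho> @ [b, c] \<in> tuples \<Phi> (fs @ [f])"
proof -
  have len: "length \<rho> = 2 * length fs"
    using assms(1) by (simp add: tuples_def)
  have "((fs @ [f]) ! i) (take (2 * i + 1) (\<rho> @ [b, c])) = Some ((\<rho> @ [b, c]) ! (2 * i + 1))"
    if "i < length (fs @ [f])" for i
  proof (cases "i < length fs")
    case True
    then show ?thesis
      using assms(1) len by (auto simp: tuples_def nth_append)
  next
    case False
    then have "i = length fs"
      using that by simp
    then show ?thesis
      using assms(4) len by (simp add: nth_append)
  qed
  then show ?thesis
    using assms len by (auto simp: tuples_def)
qed

text \<open>A single \<open>b\<close> suffices: it fills every appended \<beta> slot and also the
  free left-hand parameter of a blocked rule.\<close>

lemma tuple_extends_or_blocked:
  assumes wf: "wf_prule \<Phi> N T r"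
    and b: "b \<in> \<Phi>"
    and "d \<le> length (prule_syms r)"
    and "\<rho> \<in> tuples \<Phi> (take (d + 1) (prule_funs r))"
  shows "(\<exists>\<tau> \<in> tuples \<Phi> (prule_funs r). take (2 * (d + 1)) \<tau> = \<rho>) \<or>
    (\<exists>h \<sigma>. blocked \<Phi> r h \<sigma> b b \<and> d \<le> h - 1 \<and> take (2 * (d + 1)) \<sigma> = \<rho>)"
  using assms(3,4)
\<comment> \<open>\<open>d\<close> descends from the full right-hand side length, where \<rho> is
  already complete; \<rho> varies because the hypothesis concerns a longer tuple.\<close>
proof (induction arbitrary: \<rho> rule: inc_induct)
  case base
  then have "\<rho> \<in> tuples \<Phi> (prule_funs r)"
    by (simp add: length_prule_funs)
  moreover from this have "length \<rho> = 2 * (length (prule_syms r) + 1)"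
    by (simp add: tuples_def length_prule_funs)
  ultimately show ?case
    by (intro disjI1 bexI[of _ \<rho>]) auto
next
  case (step n)
  let ?f = "prule_funs r ! (n + 1)"
  have n: "n + 1 < length (prule_funs r)"
    using step.hyps by (simp add: length_prule_funs)
  have len: "length \<rho> = 2 * (n + 1)"
    using step.prems n by (simp add: tuples_def)
  show ?case
  proof (cases "?f (\<rho> @ [b])")
    case None
    \<comment> \<open>With \<open>h = n + 1\<close>, \<open>?f\<close> is the function that must be
      undefined, and \<rho> itself serves as \<sigma>, so \<open>d = h - 1\<close> is the boundary
      case.\<close>
    then have "blocked \<Phi> r (n + 1) \<rho> b b"
      using step b by (simp add: blocked_def)
    then show ?thesis
      using len by (intro disjI2 exI[of _ "n + 1"] exI[of _ \<rho>]) simp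
  next
    case (Some c)
    have "ran ?f \<subseteq> \<Phi>"
      using wf n by (auto simp: wf_prule_def partial_function_on_def)
    then have "c \<in> \<Phi>"
      using Some by (auto intro: ranI)
    then have "\<rho> @ [b, c] \<in> tuples \<Phi> (take (Suc n + 1) (prule_funs r))"
      using tuples_snoc[where f = ?f, OF step.prems b _ Some] n by (simp add: take_Suc_conv_app_nth)
    note IH = step.IH[OF this]
    \<comment> \<open>The induction hypothesis fixes a prefix two entries longer; cutting off
      \<open>b\<close> and \<open>c\<close> recovers \<rho>.\<close>
    have restrict: "take (2 * (n + 1)) xs = \<rho>"
      if "take (2 * (Suc n + 1)) xs = \<rho> @ [b, c]" for xs
    proof -
      have "take (2 * (n + 1)) xs = take (2 * (n + 1)) (take (2 * (Suc n + 1)) xs)"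
        by (simp add: min_def)
      also have "\<dots> = \<rho>"
        unfolding that using len by simp
      finally show ?thesis .
    qed
    show ?thesis
      using IH restrict by (meson Suc_leD)
  qed
qed

theorem theorem1:
  fixes P :: "('p, 's, 'c, 'lexer, 'selector) pll"
    and D :: "'c list"
    and x :: "('s, 'p) pitem"
  assumes "parameterized_local_lexing P"
    and "D \<in> lists (characters P)"
    and "x \<in> parameterized_items P D"
  shows "induced_items P x \<noteq> {}"
proof -
  obtain r d i j \<rho> where x: "x = (r, d, i, j, \<rho>)"
    by (cases x)
  have "wf_prule (params P) (nonterminals P) (terminals P) r" "start_param P \<in> params P"
    "d \<le> length (prule_syms r)" "\<rho> \<in> tuples (params P) (take (d + 1) (prule_funs r))"
    using assms(1,3) by (auto simp: x parameterized_local_lexing_def parameterized_items_def)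
  \<comment> \<open>\<open>start_param P\<close> is the element of \<Phi> chosen as
    \<open>b\<close>.\<close>
  from tuple_extends_or_blocked[OF this] show ?thesis
    unfolding x induced_items.simps by blast
qed

end
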